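(* Let $d\geq 1$ be an arbitrary integer, and let $(a_n)_{n=0}^{\infty}\subset S^d$ be a greedy $\lambda$-energy sequence for $\lambda>2$. Let $\alpha_{N,\lambda}=(a_0,\ldots,a_{N-1})$, $\sigma_{N,\lambda}=\frac1N\sum_{k=0}^{N-1}\delta_{a_k}$, and $U_n(x)=\sum_{k=0}^{n-1}|x-a_k|^\lambda$. Then, for each $k\geq 0$, $$\{a_{2k},a_{2k+1}\}=\{a_0,-a_0\}.$$ For each $n\geq 1$, $$H_\lambda(\alpha_{2n,\lambda})=2^{\lambda+1}\,n^2,\qquad H_\lambda(\alpha_{2n+1,\lambda})=2^{\lambda+1}\,(n^2+n).$$ For each $n\geq 1$, $$U_{2n-1}(a_{2n-1})=U_{2n}(a_{2n})=n\,2^\lambda.$$ In particular, $$\lim_{N\to\infty}\frac{H_\lambda(\alpha_{N,\lambda})}{N^2}=\lim_{n\to\infty}\frac{U_n(a_n)}{n}=2^{\lambda-1},$$ and $\sigma_{N,\lambda}$ converges in the weak-star topology to $\frac12\delta_{a_0}+\frac12\delta_{-a_0}$ as $N\to\infty$.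
   Context: $S^d=\{x\in\mathbb{R}^{d+1}:|x|=1\}$, where $|\cdot|$ is the Euclidean norm. For $\lambda>0$, a greedy $\lambda$-energy sequence on $S^d$ is a sequence $(a_n)_{n=0}^{\infty}\subset S^d$ such that $\sum_{k=0}^{n-1}|a_n-a_k|^{\lambda}=\max_{x\in S^d}\sum_{k=0}^{n-1}|x-a_k|^{\lambda}$ for all $n\geq 1$. For a configuration $\omega_N=(y_0,\ldots,y_{N-1})$ of $N\ge2$ points of $S^d$ (not necessarily distinct), $H_\lambda(\omega_N)=\sum_{0\le i\neq j\le N-1}|y_i-y_j|^\lambda$. $\delta_a$ is the Dirac unit measure at $a$. Weak-star convergence $\mu_n\to\mu$ means $\int f\,d\mu_n\to\int f\,d\mu$ for every continuous $f:S^d\to\mathbb{R}$. *)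

theory Defs
  imports "HOL-Analysis.Analysis" "HOL-Probability.Giry_Monad"
begin

text \<open>The sphere \<open>S\<^sup>d\<close> is \<open>sphere 0 1 :: (real ^ 'n) set\<close> with \<open>CARD('n) = d + 1\<close>.
  In all powers below \<open>lam > 0\<close> is intended, so that \<open>0 powr lam = 0\<close> is the correct
  value for coinciding points.\<close>

definition potential :: "real \<Rightarrow> (nat \<Rightarrow> real ^ 'n) \<Rightarrow> nat \<Rightarrow> real ^ 'n \<Rightarrow> real" where
  "potential lam a n x = (\<Sum>k<n. norm (x - a k) powr lam)"

definition greedy_energy_sequence :: "real \<Rightarrow> (nat \<Rightarrow> real ^ 'n) \<Rightarrow> bool" where
  "greedy_energy_sequence lam a \<longleftrightarrow>
     (\<forall>n. a n \<in> sphere 0 1) \<and>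
     (\<forall>n\<ge>1. \<forall>x\<in>sphere 0 1. potential lam a n x \<le> potential lam a n (a n))"

text \<open>The sum ranges over ordered pairs of distinct indices, and a configuration of \<open>N\<close> points is
  given by the first \<open>N\<close> values of a function.\<close>

definition energy :: "real \<Rightarrow> nat \<Rightarrow> (nat \<Rightarrow> real ^ 'n) \<Rightarrow> real" where
  "energy lam N y = (\<Sum>(i, j) \<in> {(i, j). i < N \<and> j < N \<and> i \<noteq> j}. norm (y i - y j) powr lam)"

definition sphere_borel :: "(real ^ 'n) measure" where
  "sphere_borel = restrict_space borel (sphere 0 1)"

text \<open>The Dirac measure at \<open>x\<close> on the sphere is \<open>return sphere_borel x\<close>. The following is the
  setwise sum of finitely many measures on the measurable space \<open>R\<close>.\<close>

definition measure_sum :: "'a measure \<Rightarrow> 'a measure list \<Rightarrow> 'a measure" where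
  "measure_sum R Ms = measure_of (space R) (sets R) (\<lambda>A. \<Sum>M\<leftarrow>Ms. emeasure M A)"

lemma sets_measure_sum [simp]: "sets (measure_sum R Ms) = sets R"
  and space_measure_sum [simp]: "space (measure_sum R Ms) = space R"
  by (simp_all add: measure_sum_def)

lemma emeasure_measure_sum:
  assumes "\<And>M. M \<in> set Ms \<Longrightarrow> sets M = sets R" and A: "A \<in> sets R"
  shows "emeasure (measure_sum R Ms) A = (\<Sum>M\<leftarrow>Ms. emeasure M A)"
proof (rule emeasure_measure_of[OF measure_sum_def])
  show "countably_additive (sets (measure_sum R Ms)) (\<lambda>A. \<Sum>M\<leftarrow>Ms. emeasure M A)"
  proof (rule countably_additiveI)
    fix B :: "nat \<Rightarrow> 'a set"
    assume B: "range B \<subseteq> sets (measure_sum R Ms)" and disj: "disjoint_family B"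
    from assms(1) have "(\<Sum>i. \<Sum>M\<leftarrow>Ms. emeasure M (B i)) = (\<Sum>M\<leftarrow>Ms. emeasure M (\<Union>i. B i))"
    proof (induction Ms)
      case Nil
      then show ?case by simp
    next
      case (Cons M Ms)
      have "(\<Sum>i. emeasure M (B i)) = emeasure M (\<Union>i. B i)"
        using B disj Cons.prems[of M] by (intro suminf_emeasure) auto
      moreover have "(\<Sum>i. emeasure M (B i) + (\<Sum>M\<leftarrow>Ms. emeasure M (B i))) =
          (\<Sum>i. emeasure M (B i)) + (\<Sum>i. \<Sum>M\<leftarrow>Ms. emeasure M (B i))"
        by (rule suminf_add[symmetric]) (auto intro: summableI)
      ultimately show ?case using Cons by simp
    qed
    then show "(\<Sum>i. \<Sum>M\<leftarrow>Ms. emeasure M (B i)) = (\<Sum>M\<leftarrow>Ms. emeasure M (\<Union>i. B i))" .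
  qed
  show "positive (sets (measure_sum R Ms)) (\<lambda>A. \<Sum>M\<leftarrow>Ms. emeasure M A)"
    by (induction Ms) (auto simp: positive_def)
qed (use A sets.space_closed in auto)

text \<open>For \<open>N = 0\<close> this is the zero measure, since \<open>1 / 0 = 0\<close> over the reals; this does
  not affect limits as \<open>N \<rightarrow> \<infinity>\<close>.\<close>

definition empirical_measure :: "(nat \<Rightarrow> real ^ 'n) \<Rightarrow> nat \<Rightarrow> (real ^ 'n) measure" where
  "empirical_measure a N =
     scale_measure (ennreal (1 / real N))
       (measure_sum sphere_borel (map (\<lambda>k. return sphere_borel (a k)) [0..<N]))"

definition weak_star_converges ::
    "(nat \<Rightarrow> (real ^ 'n) measure) \<Rightarrow> (real ^ 'n) measure \<Rightarrow> bool" where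
  "weak_star_converges M L \<longleftrightarrow>
     (\<forall>f :: real ^ 'n \<Rightarrow> real. continuous_on (sphere 0 1) f \<longrightarrow>
        (\<lambda>N. integral\<^sup>L (M N) f) \<longlonglongrightarrow> integral\<^sup>L L f)"

end

theory Submission
  imports Defs
begin

text \<open>
  Put \<open>p = a 0\<close>. Everything rests on one inequality (\<open>antipodal_powr_sum_le\<close> and
  \<open>antipodal_powr_sum_less\<close>): for \<open>lam > 2\<close>, the function
  \<open>\<bar>x - p\<bar>\<^sup>lam + \<bar>x + p\<bar>\<^sup>lam\<close> on the sphere is maximal exactly at \<open>x = p\<close> and \<open>x = -p\<close>. Indeed, by
  the parallelogram law the numbers \<open>u = \<bar>x - p\<bar> / 2\<close> and \<open>v = \<bar>x + p\<bar> / 2\<close> satisfy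
  \<open>u\<^sup>2 + v\<^sup>2 = 1\<close>, and \<open>u\<^sup>lam < u\<^sup>2\<close> unless \<open>u\<close> is \<open>0\<close> or \<open>1\<close>.

  If the first \<open>2 * n\<close> points are \<open>n\<close> copies of \<open>p\<close> and \<open>n\<close> copies of \<open>-p\<close>, then their potential
  is \<open>n\<close> times that function, so the next point \<open>q\<close> is \<open>p\<close> or \<open>-p\<close>. Adding \<open>q\<close> adds the term
  \<open>\<bar>x - q\<bar>\<^sup>lam\<close> to the potential. Both parts are maximal at \<open>-q\<close>, the second one only there, so the
  point after \<open>q\<close> is \<open>-q\<close>. By induction the points come in antipodal pairs \<open>p, -p\<close>
  (\<open>greedy_antipodal_pairs\<close>).

  The sum of any function over the first \<open>2 * n\<close> points is therefore explicit. This gives the values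
  of the potentials, whose partial sums are half the energies, and it shows that
  the average of a function over the first \<open>N\<close> points differs from its average over \<open>p\<close> and \<open>-p\<close>
  by \<open>O(1/N)\<close>. Since integrals against the empirical measures are such averages, weak-star
  convergence follows; the limit is the empirical measure of the first two points.
\<close>

section \<open>Distances to a pair of antipodal points\<close>

text \<open>The parallelogram law, rescaled so that both summands lie in the unit interval.\<close>

lemma antipodal_half_dist_squares:
  fixes x p :: "'a :: real_inner"
  assumes "norm x = 1" "norm p = 1"
  shows "(norm (x - p) / 2)\<^sup>2 + (norm (x + p) / 2)\<^sup>2 = 1"
  using assms
  by (simp add: power_divide power2_norm_eq_inner inner_simps inner_commute norm_eq_1 field_simps)

lemma powr_eq_scaled_half:
  fixes r s lam :: real
  assumes "r \<ge> 0"
  shows "r powr lam = 2 powr lam * (r / 2) powr lam"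
  using assms by (simp add: powr_divide)

lemma powr_le_square:
  fixes u lam :: real
  assumes "0 \<le> u" "u \<le> 1" "lam > 2"
  shows "u powr lam \<le> u\<^sup>2"
proof (cases "u = 0")
  case False
  then have "u powr lam \<le> u powr 2"
    using assms by (intro powr_mono') auto
  then show ?thesis using False assms by simp
qed (use assms in simp)

lemma powr_less_square:
  fixes u lam :: real
  assumes "0 < u" "u < 1" "lam > 2"
  shows "u powr lam < u\<^sup>2"
  using powr_less_mono'[of u 2 lam] assms by simp

lemma antipodal_powr_sum_le:
  fixes x p :: "'a :: real_inner"
  assumes "norm x = 1" "norm p = 1" "lam > 2"
  shows "norm (x - p) powr lam + norm (x + p) powr lam \<le> 2 powr lam"
proof -
  define u v where "u = norm (x - p) / 2" and "v = norm (x + p) / 2"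
  have uv: "u\<^sup>2 + v\<^sup>2 = 1" "u \<ge> 0" "v \<ge> 0"
    using antipodal_half_dist_squares[OF assms(1,2)] by (auto simp: u_def v_def)
  have "u \<le> 1" "v \<le> 1"
    using uv zero_le_power2[of u] zero_le_power2[of v] abs_square_le_1[of u] abs_square_le_1[of v]
    by linarith+
  then have "u powr lam + v powr lam \<le> 1"
    using powr_le_square[of u lam] powr_le_square[of v lam] uv assms(3) by linarith
  then have "2 powr lam * (u powr lam + v powr lam) \<le> 2 powr lam"
    by simp
  then show ?thesis
    using powr_eq_scaled_half[of "norm (x - p)" lam] powr_eq_scaled_half[of "norm (x + p)" lam]
    by (simp add: u_def v_def distrib_left)
qed

lemma antipodal_powr_sum_less:
  fixes x p :: "'a :: real_inner"
  assumes "norm x = 1" "norm p = 1" "lam > 2" "x \<noteq> p" "x \<noteq> - p"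
  shows "norm (x - p) powr lam + norm (x + p) powr lam < 2 powr lam"
proof -
  define u v where "u = norm (x - p) / 2" and "v = norm (x + p) / 2"
  have uv: "u\<^sup>2 + v\<^sup>2 = 1"
    using antipodal_half_dist_squares[OF assms(1,2)] by (auto simp: u_def v_def)
  have pos: "u > 0" "v > 0"
    using assms(4,5) by (auto simp: u_def v_def add_eq_0_iff2)
  then have "u\<^sup>2 < 1" "v\<^sup>2 < 1"
    using uv zero_less_power[of u 2] zero_less_power[of v 2] by linarith+
  then have "u < 1" "v < 1"
    using pos by (auto simp: power2_less_1_iff abs_less_iff)
  then have "u powr lam + v powr lam < 1"
    using powr_less_square[of u lam] powr_less_square[of v lam] pos uv assms(3) by linarith
  then have "2 powr lam * (u powr lam + v powr lam) < 2 powr lam"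
    by simp
  then show ?thesis
    using powr_eq_scaled_half[of "norm (x - p)" lam] powr_eq_scaled_half[of "norm (x + p)" lam]
    by (simp add: u_def v_def distrib_left)
qed

text \<open>By the parallelogram law again, \<open>\<bar>x - q\<bar> \<ge> 2\<close> leaves no room for a nonzero \<open>\<bar>x + q\<bar>\<close>.
  This is why the second point of each pair is unique.\<close>

lemma antipodal_if_dist_ge_2:
  fixes x q :: "'a :: real_inner"
  assumes "norm x = 1" "norm q = 1" "norm (x - q) \<ge> 2"
  shows "x = - q"
proof -
  have "1 \<le> (norm (x - q) / 2)\<^sup>2"
    using assms(3) by (intro one_le_power) simp
  then have "(norm (x + q) / 2)\<^sup>2 \<le> 0"
    using antipodal_half_dist_squares[OF assms(1,2)] by linarith
  then show ?thesis by (simp add: add_eq_0_iff2)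
qed

section \<open>Sequences made of antipodal pairs\<close>

definition antipodal_pair :: "(nat \<Rightarrow> 'a :: real_vector) \<Rightarrow> nat \<Rightarrow> bool" where
  "antipodal_pair a k \<longleftrightarrow> a (2 * k) \<in> {a 0, - a 0} \<and> a (2 * k + 1) = - a (2 * k)"

lemma sum_antipodal_pairs:
  fixes g :: "'a :: real_vector \<Rightarrow> real"
  assumes "\<And>k. k < n \<Longrightarrow> antipodal_pair a k"
  shows "(\<Sum>k<2 * n. g (a k)) = real n * (g (a 0) + g (- a 0))"
  using assms
proof (induction n)
  case (Suc n)
  have "g (a (2 * n)) + g (a (2 * n + 1)) = g (a 0) + g (- a 0)"
    using Suc.prems[of n] by (auto simp: antipodal_pair_def)
  then show ?case
    using Suc by (simp add: algebra_simps)
qed simp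

lemma potential_antipodal_pairs:
  assumes "\<And>k. k < n \<Longrightarrow> antipodal_pair a k"
  shows "potential lam a (2 * n) x =
    real n * (norm (x - a 0) powr lam + norm (x + a 0) powr lam)"
  using sum_antipodal_pairs[OF assms, of n "\<lambda>y. norm (x - y) powr lam"]
  by (simp add: potential_def)

lemma potential_Suc:
  "potential lam a (Suc n) x = potential lam a n x + norm (x - a n) powr lam"
  by (simp add: potential_def)

lemma greedy_antipodal_pairs:
  fixes a :: "nat \<Rightarrow> real ^ 'n"
  assumes lam: "lam > 2" and greedy: "greedy_energy_sequence lam a"
  shows "antipodal_pair a k"
proof (induction k rule: less_induct)
  case (less k)
  have norm_a: "norm (a i) = 1" for i
    using greedy by (auto simp: greedy_energy_sequence_def)
  have max_a: "potential lam a n x \<le> potential lam a n (a n)" if "n \<ge> 1" "norm x = 1" for n x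
    using greedy that by (auto simp: greedy_energy_sequence_def)
  define V where "V x = norm (x - a 0) powr lam + norm (x + a 0) powr lam" for x
  have pot: "potential lam a (2 * k) x = real k * V x" for x
    unfolding V_def using less by (intro potential_antipodal_pairs)
  have V_le: "V x \<le> 2 powr lam" if "norm x = 1" for x
    unfolding V_def using that norm_a lam by (intro antipodal_powr_sum_le)
  have V_a0: "V (a 0) = 2 powr lam" and V_uminus: "V (- x) = V x" for x
    using lam norm_a[of 0] norm_minus_commute[of "- x" "a 0"] norm_minus_cancel[of "x + a 0"]
    by (auto simp: V_def algebra_simps norm_minus_commute simp flip: scaleR_2)
  have even: "a (2 * k) \<in> {a 0, - a 0}"
  proof (cases "k = 0")
    case False
    then have "V (a 0) \<le> V (a (2 * k))"
      using max_a[of "2 * k" "a 0"] norm_a[of 0] by (simp add: pot)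
    then have "\<not> V (a (2 * k)) < 2 powr lam"
      by (simp add: V_a0)
    then show ?thesis
      using antipodal_powr_sum_less[of "a (2 * k)" "a 0" lam] norm_a lam by (auto simp: V_def)
  qed simp
  \<comment> \<open>Comparing the potential at the new point \<open>a (2 * k + 1)\<close> with that at the antipode \<open>-q\<close> of
    \<open>q = a (2 * k)\<close>, the contribution of the complete pairs is maximal at \<open>-q\<close>.\<close>
  define q x where "q = a (2 * k)" and "x = a (2 * k + 1)"
  have nq: "norm q = 1" and nx: "norm x = 1"
    using norm_a by (auto simp: q_def x_def)
  have Vq: "V (- q) = 2 powr lam"
    using even V_a0 V_uminus unfolding q_def by auto
  have "norm (- q - q) = 2"
    using nq by (simp flip: scaleR_2 minus_add_distrib add: diff_conv_add_uminus)
  then have "real k * 2 powr lam + 2 powr lam \<le> real k * V x + norm (x - q) powr lam"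
    using max_a[of "2 * k + 1" "- q"] nq Vq by (simp add: potential_Suc pot q_def x_def)
  moreover have "real k * V x \<le> real k * 2 powr lam"
    using V_le[OF nx] by (intro mult_left_mono) auto
  ultimately have "2 powr lam \<le> norm (x - q) powr lam"
    by linarith
  then have "2 \<le> norm (x - q)"
    using lam powr_less_mono2[of lam "norm (x - q)" 2] by (cases "norm (x - q) < 2") auto
  then have "x = - q"
    using nx nq by (intro antipodal_if_dist_ge_2)
  then show ?case
    using even by (simp add: antipodal_pair_def q_def x_def)
qed

section \<open>Potentials and energies\<close>

text \<open>Each earlier point at the antipode of the new point contributes \<open>2 powr lam\<close>, each earlier
  copy of the new point nothing. The antipodal ones are one from each complete pair and, for odd
  \<open>N\<close>, also the partner of the new point.\<close>

lemma potential_at_next_point: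
  fixes a :: "nat \<Rightarrow> real ^ 'n"
  assumes lam: "lam > 0" and norm_a: "norm (a 0) = 1" and pairs: "\<And>k. antipodal_pair a k"
  shows "potential lam a N (a N) = real ((N + 1) div 2) * 2 powr lam"
proof -
  define n where "n = N div 2"
  have even: "a (2 * n) \<in> {a 0, - a 0}" and odd: "a (2 * n + 1) = - a (2 * n)"
    using pairs[of n] by (auto simp: antipodal_pair_def)
  have double: "norm (z + z) = 2" "norm (- z - z) = 2" if "norm z = 1" for z :: "real ^ 'n"
    using that by (simp_all flip: scaleR_2 minus_add_distrib add: diff_conv_add_uminus)
  have pot: "potential lam a (2 * n) z = real n * 2 powr lam" if "z \<in> {a 0, - a 0}" for z
    using that
      potential_antipodal_pairs[OF pairs, where n = n and lam = lam and x = z] double[OF norm_a] lam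
    by auto
  consider "N = 2 * n" | "N = 2 * n + 1"
    unfolding n_def by linarith
  then show ?thesis
  proof cases
    case 1
    then show ?thesis using pot[OF even] by simp
  next
    case 2
    have "norm (- a (2 * n) - a (2 * n)) = 2"
      using even norm_a by (intro double) auto
    moreover have "- a (2 * n) \<in> {a 0, - a 0}"
      using even by auto
    ultimately show ?thesis
      using 2 odd pot[of "- a (2 * n)"] by (simp add: potential_Suc algebra_simps)
  qed
qed

lemma energy_Suc:
  "energy lam (Suc N) a = energy lam N a + 2 * potential lam a N (a N)"
proof -
  define D where "D = (\<lambda>N. {(i, j). i < N \<and> j < N \<and> i \<noteq> (j :: nat)})"
  define F where "F = (\<lambda>(i, j). norm (a i - a j) powr lam)"
  have D_fin: "finite (D N)" for N
    by (rule finite_subset[of _ "{..<N} \<times> {..<N}"]) (auto simp: D_def)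
  have split: "D (Suc N) = D N \<union> (Pair N ` {..<N} \<union> (\<lambda>i. (i, N)) ` {..<N})"
    by (auto simp: D_def)
  have "sum F (D (Suc N)) = sum F (D N) + (sum F (Pair N ` {..<N}) + sum F ((\<lambda>i. (i, N)) ` {..<N}))"
    unfolding split using D_fin
    by (subst sum.union_disjoint, auto simp: D_def)+
  also have "sum F (Pair N ` {..<N}) = potential lam a N (a N)"
    by (subst sum.reindex) (auto simp: inj_on_def F_def potential_def)
  also have "sum F ((\<lambda>i. (i, N)) ` {..<N}) = potential lam a N (a N)"
    by (subst sum.reindex) (auto simp: inj_on_def F_def potential_def norm_minus_commute)
  finally show ?thesis
    by (simp add: energy_def D_def F_def)
qed

lemma energy_eq_if_potential_eq:
  assumes "\<And>N. potential lam a N (a N) = real ((N + 1) div 2) * c"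
  shows "energy lam N a = 2 * c * (real (N div 2) * real ((N + 1) div 2))"
proof (induction N)
  case 0
  then show ?case by (simp add: energy_def)
next
  case (Suc N)
  have "Suc N div 2 = (N + 1) div 2" "(Suc N + 1) div 2 = N div 2 + 1"
    by auto
  then show ?case
    using Suc by (simp add: energy_Suc assms algebra_simps)
qed

section \<open>Averages\<close>

lemma tendsto_average_if_bounded_error:
  fixes X :: "nat \<Rightarrow> real"
  assumes "\<And>N. \<bar>X N - real N * L\<bar> \<le> C"
  shows "(\<lambda>N. X N / real N) \<longlonglongrightarrow> L"
proof (rule LIM_zero_cancel, rule Lim_null_comparison)
  show "\<forall>\<^sub>F N in sequentially. norm (X N / real N - L) \<le> C / real N"
    using eventually_gt_at_top[of 0]
  proof eventually_elim
    case (elim N)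
    then have "X N / real N - L = (X N - real N * L) / real N"
      by (simp add: field_simps)
    then show ?case
      using assms[of N] by (simp add: abs_divide divide_right_mono)
  qed
  show "(\<lambda>N. C / real N) \<longlonglongrightarrow> 0"
    by (rule lim_const_over_n)
qed

lemma tendsto_half_div: "(\<lambda>N. real (N div 2) / real N) \<longlonglongrightarrow> 1 / 2"
  and tendsto_half_Suc_div: "(\<lambda>N. real ((N + 1) div 2) / real N) \<longlonglongrightarrow> 1 / 2"
proof -
  have "\<bar>real (N div 2) - real N * (1 / 2)\<bar> \<le> 1" "\<bar>real ((N + 1) div 2) - real N * (1 / 2)\<bar> \<le> 1" for N
    by linarith+
  from this[THEN tendsto_average_if_bounded_error]
  show "(\<lambda>N. real (N div 2) / real N) \<longlonglongrightarrow> 1 / 2"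
    and "(\<lambda>N. real ((N + 1) div 2) / real N) \<longlonglongrightarrow> 1 / 2"
    by simp_all
qed

text \<open>Complete pairs contribute exactly the average over the two points, so the only error comes
  from an unpaired last point when \<open>N\<close> is odd.\<close>

lemma tendsto_average_antipodal_pairs:
  fixes g :: "'a :: real_vector \<Rightarrow> real"
  assumes pairs: "\<And>k. antipodal_pair a k"
  shows "(\<lambda>N. (\<Sum>k<N. g (a k)) / real N) \<longlonglongrightarrow> (g (a 0) + g (- a 0)) / 2"
proof (rule tendsto_average_if_bounded_error)
  fix N :: nat
  define n where "n = N div 2"
  have S: "(\<Sum>k<2 * n. g (a k)) = real n * (g (a 0) + g (- a 0))"
    using pairs by (rule sum_antipodal_pairs)
  have last: "g (a (2 * n)) \<in> {g (a 0), g (- a 0)}"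
    using pairs[of n] by (auto simp: antipodal_pair_def)
  consider "N = 2 * n" | "N = 2 * n + 1"
    unfolding n_def by linarith
  then show "\<bar>(\<Sum>k<N. g (a k)) - real N * ((g (a 0) + g (- a 0)) / 2)\<bar> \<le> \<bar>g (a 0) - g (- a 0)\<bar> / 2"
  proof cases
    case 2
    then have "(\<Sum>k<N. g (a k)) - real N * ((g (a 0) + g (- a 0)) / 2)
        = g (a (2 * n)) - (g (a 0) + g (- a 0)) / 2"
      using S by (simp add: algebra_simps add_divide_distrib)
    then show ?thesis
      using last by (auto simp: abs_if field_simps)
  qed (simp add: S)
qed

section \<open>Integrals against empirical measures\<close>

text \<open>Viewing a finite sum of Dirac measures as an image of a counting measure turns integrals
  against it into finite sums by the change-of-variables formula.\<close>

lemma measure_sum_return_eq_distr: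
  assumes y: "\<And>k. k < N \<Longrightarrow> y k \<in> space R"
  shows "measure_sum R (map (\<lambda>k. return R (y k)) [0..<N]) = distr (count_space {..<N}) R y"
proof (rule measure_eqI)
  fix A
  assume "A \<in> sets (measure_sum R (map (\<lambda>k. return R (y k)) [0..<N]))"
  then have A: "A \<in> sets R" by simp
  have "emeasure (measure_sum R (map (\<lambda>k. return R (y k)) [0..<N])) A
      = (\<Sum>k<N. indicator A (y k))"
    using A by (subst emeasure_measure_sum)
      (auto simp: comp_def interv_sum_list_conv_sum_set_nat atLeast0LessThan)
  also have "\<dots> = of_nat (card (y -` A \<inter> {..<N}))"
    by (simp add: indicator_def sum_of_bool_eq vimage_def Int_commute)
  also have "\<dots> = emeasure (distr (count_space {..<N}) R y) A"
    using A y by (subst emeasure_distr) (auto simp: emeasure_count_space)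
  finally show "emeasure (measure_sum R (map (\<lambda>k. return R (y k)) [0..<N])) A
      = emeasure (distr (count_space {..<N}) R y) A" .
qed simp

lemma integral_scale_measure_ennreal:
  fixes f :: "'a \<Rightarrow> real"
  assumes "0 \<le> c" "f \<in> borel_measurable M"
  shows "integral\<^sup>L (scale_measure (ennreal c) M) f = c * integral\<^sup>L M f"
proof -
  have "scale_measure (ennreal c) M = density M (\<lambda>_. ennreal c)"
    by (rule measure_eqI) (auto simp: emeasure_density nn_integral_cmult_indicator)
  then show ?thesis
    using assms by (simp add: integral_real_density)
qed

lemma integral_empirical_measure:
  fixes f :: "real ^ 'n \<Rightarrow> real"
  assumes y: "\<And>k. y k \<in> sphere 0 1" and f: "continuous_on (sphere 0 1) f"
  shows "integral\<^sup>L (empirical_measure y N) f = (\<Sum>k<N. f (y k)) / real N"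
proof -
  have f': "f \<in> borel_measurable sphere_borel"
    unfolding sphere_borel_def using f by (rule borel_measurable_continuous_on_restrict)
  have y': "y k \<in> space sphere_borel" for k
    using y by (simp add: sphere_borel_def space_restrict_space)
  have "integral\<^sup>L (empirical_measure y N) f
      = 1 / real N * integral\<^sup>L (distr (count_space {..<N}) sphere_borel y) f"
    unfolding empirical_measure_def measure_sum_return_eq_distr[OF y']
    using f' by (intro integral_scale_measure_ennreal) auto
  also have "integral\<^sup>L (distr (count_space {..<N}) sphere_borel y) f = (\<Sum>k<N. f (y k))"
    using f' y' by (subst integral_distr) (auto simp: lebesgue_integral_count_space_finite)
  finally show ?thesis by simp
qed

text \<open>As \<open>a 1 = - a 0\<close> for a sequence of antipodal pairs, this presents the limit measure as an
  empirical measure, whose integrals are then covered by \<open>integral_empirical_measure\<close>.\<close>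

lemma half_sum_return_eq_empirical_measure:
  "measure_sum sphere_borel
     [scale_measure (ennreal (1 / 2)) (return sphere_borel (y 0)),
      scale_measure (ennreal (1 / 2)) (return sphere_borel (y 1))] = empirical_measure y 2"
  (is "?L = _")
proof (rule measure_eqI)
  fix A
  assume "A \<in> sets ?L"
  then have A: "A \<in> sets sphere_borel" by simp
  have "emeasure ?L A = ennreal (1 / 2) * (indicator A (y 0) + indicator A (y 1))"
    using A by (subst emeasure_measure_sum) (auto simp: distrib_left)
  also have "indicator A (y 0) + indicator A (y 1) =
      emeasure (measure_sum sphere_borel (map (\<lambda>k. return sphere_borel (y k)) [0..<2])) A"
    using A by (subst emeasure_measure_sum) (auto simp: numeral_2_eq_2)
  finally show "emeasure ?L A = emeasure (empirical_measure y 2) A"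
    by (simp add: empirical_measure_def)
qed (simp add: empirical_measure_def)

section \<open>Greedy energy sequences for exponents above two\<close>

theorem theorem5p2:
  fixes d :: nat and lam :: real and a :: "nat \<Rightarrow> real ^ 'n"
  assumes "d \<ge> 1" and "CARD('n) = d + 1"
    and "lam > 2"
    and "greedy_energy_sequence lam a"
  shows "(\<forall>k. {a (2 * k), a (2 * k + 1)} = {a 0, - a 0}) \<and>
    (\<forall>n\<ge>1. energy lam (2 * n) a = 2 powr (lam + 1) * (real n)\<^sup>2 \<and>
            energy lam (2 * n + 1) a = 2 powr (lam + 1) * ((real n)\<^sup>2 + real n)) \<and>
    (\<forall>n\<ge>1. potential lam a (2 * n - 1) (a (2 * n - 1)) = real n * 2 powr lam \<and>
            potential lam a (2 * n) (a (2 * n)) = real n * 2 powr lam) \<and>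
    (\<lambda>N. energy lam N a / (real N)\<^sup>2) \<longlonglongrightarrow> 2 powr (lam - 1) \<and>
    (\<lambda>n. potential lam a n (a n) / real n) \<longlonglongrightarrow> 2 powr (lam - 1) \<and>
    weak_star_converges (empirical_measure a)
      (measure_sum sphere_borel
        [scale_measure (ennreal (1 / 2)) (return sphere_borel (a 0)),
         scale_measure (ennreal (1 / 2)) (return sphere_borel (- a 0))])"
proof (intro conjI)
  have sphere: "a k \<in> sphere 0 1" for k
    using assms(4) by (simp add: greedy_energy_sequence_def)
  have pairs: "antipodal_pair a k" for k
    using assms(3,4) by (rule greedy_antipodal_pairs)
  have pot: "potential lam a N (a N) = real ((N + 1) div 2) * 2 powr lam" for N
    using assms(3) sphere[of 0] pairs by (intro potential_at_next_point) auto
  have en: "energy lam N a = 2 * 2 powr lam * (real (N div 2) * real ((N + 1) div 2))" for N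
    using pot by (rule energy_eq_if_potential_eq)
  have powr_minus: "2 powr (lam - 1) = 2 powr lam / 2"
    by (simp add: powr_diff)
  show "\<forall>k. {a (2 * k), a (2 * k + 1)} = {a 0, - a 0}"
  proof
    show "{a (2 * k), a (2 * k + 1)} = {a 0, - a 0}" for k
      using pairs[of k] by (auto simp: antipodal_pair_def)
  qed
  show "\<forall>n\<ge>1. energy lam (2 * n) a = 2 powr (lam + 1) * (real n)\<^sup>2 \<and>
            energy lam (2 * n + 1) a = 2 powr (lam + 1) * ((real n)\<^sup>2 + real n)"
    by (simp add: en powr_add power2_eq_square algebra_simps)
  show "\<forall>n\<ge>1. potential lam a (2 * n - 1) (a (2 * n - 1)) = real n * 2 powr lam \<and>
            potential lam a (2 * n) (a (2 * n)) = real n * 2 powr lam"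
    by (simp add: pot)
  have "(\<lambda>N. 2 * 2 powr lam * (real (N div 2) / real N * (real ((N + 1) div 2) / real N)))
      \<longlonglongrightarrow> 2 * 2 powr lam * (1 / 2 * (1 / 2))"
    by (intro tendsto_intros tendsto_half_div tendsto_half_Suc_div)
  then show "(\<lambda>N. energy lam N a / (real N)\<^sup>2) \<longlonglongrightarrow> 2 powr (lam - 1)"
    by (simp add: en powr_minus power2_eq_square)
  have "(\<lambda>N. real ((N + 1) div 2) / real N * 2 powr lam) \<longlonglongrightarrow> 1 / 2 * 2 powr lam"
    by (intro tendsto_intros tendsto_half_Suc_div)
  then show "(\<lambda>n. potential lam a n (a n) / real n) \<longlonglongrightarrow> 2 powr (lam - 1)"
    by (simp add: pot powr_minus)
  have a1: "a 1 = - a 0"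
    using pairs[of 0] by (simp add: antipodal_pair_def)
  have "(\<lambda>N. integral\<^sup>L (empirical_measure a N) f) \<longlonglongrightarrow> integral\<^sup>L (empirical_measure a 2) f"
    if "continuous_on (sphere 0 1) f" for f :: "real ^ 'n \<Rightarrow> real"
    using tendsto_average_antipodal_pairs[OF pairs, of f] a1
    by (simp add: integral_empirical_measure[OF sphere that] numeral_2_eq_2)
  then show "weak_star_converges (empirical_measure a)
      (measure_sum sphere_borel
        [scale_measure (ennreal (1 / 2)) (return sphere_borel (a 0)),
         scale_measure (ennreal (1 / 2)) (return sphere_borel (- a 0))])"
    using half_sum_return_eq_empirical_measure[of a] a1 by (simp add: weak_star_converges_def)
qed

end
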